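(* Let $n\geq 1$, let $U_1,\ldots,U_n$ be i.i.d. random variables uniform on $[0,1]$, and define the random set $\mathcal{U}:=\{U_1,\ldots,U_n\}$. There exists a measurable function $g:[0,1]^{\{n\}}\to[0,1]^{\{n-1\}}$ such that $g(A)\subset A$ for all $A\in[0,1]^{\{n\}}$, and $$g(\mathcal{U})\stackrel{d}{=}\{U_1,\ldots,U_{n-1}\}.$$ Moreover, there exists a measurable function $v:[0,1]^{\{n\}}\to[0,1]$ such that $v(\mathcal{U})$ is uniform on $[0,1]$ and is independent of $g(\mathcal{U})$.
   Context: For a set $B$, $B^{\{n\}}$ denotes the set of all subsets of $B$ of size $n$. For Borel $B$, this carries the natural $\sigma$-algebra obtained by identifying a finite set $A$ with its counting measure, i.e. generated by the maps $A\mapsto |A\cap C|$ for $C\subseteq B$ Borel. The random set $\mathcal{U}$ has exactly $n$ elements almost surely. $\stackrel{d}{=}$ denotes equality in distribution. *)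

theory Defs
  imports "HOL-Probability.Probability" "HOL-Library.Ramsey"
begin

(* The generators are the preimages of arbitrary sets K of naturals under the counting
   maps A \<mapsto> card (A \<inter> C). The members of nsets B n are finite, so card is a true count. *)
definition nsets_algebra :: "real set \<Rightarrow> nat \<Rightarrow> real set measure" where
  "nsets_algebra B n = sigma (nsets B n)
     {(\<lambda>A. card (A \<inter> C)) -` K \<inter> nsets B n | C K. C \<in> sets borel \<and> C \<subseteq> B}"

definition random_set :: "(nat \<Rightarrow> 'a \<Rightarrow> real) \<Rightarrow> nat \<Rightarrow> 'a \<Rightarrow> real set" where
  "random_set U n \<omega> = (\<lambda>i. U i \<omega>) ` {1..n}"

(* A random set is in nsets B n only almost surely. We discard the exceptional null event,
   so that the random set becomes a genuine random element of nsets_algebra B n;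
   proper_event below shows that the discarded event is null in the case of interest. *)
definition proper_space :: "'a measure \<Rightarrow> ('a \<Rightarrow> real set) \<Rightarrow> real set \<Rightarrow> nat \<Rightarrow> 'a measure" where
  "proper_space M X B n = restrict_space M {\<omega> \<in> space M. X \<omega> \<in> nsets B n}"

(* prob_space.indep_var forces both variables to take values in one type;
   this is the same notion for two value types. *)
definition indep_rv ::
  "'a measure \<Rightarrow> 'b measure \<Rightarrow> ('a \<Rightarrow> 'b) \<Rightarrow> 'c measure \<Rightarrow> ('a \<Rightarrow> 'c) \<Rightarrow> bool" where
  "indep_rv M S X T Y \<longleftrightarrow> X \<in> M \<rightarrow>\<^sub>M S \<and> Y \<in> M \<rightarrow>\<^sub>M T \<and>
     prob_space.indep_set M {X -` A \<inter> space M | A. A \<in> sets S} {Y -` A \<inter> space M | A. A \<in> sets T}"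

lemma space_nsets_algebra [simp]: "space (nsets_algebra B n) = nsets B n"
  unfolding nsets_algebra_def by (rule space_measure_of) auto

lemma random_set_in_nsets_iff:
  "random_set U n \<omega> \<in> nsets B n \<longleftrightarrow>
     (\<forall>i\<in>{1..n}. U i \<omega> \<in> B) \<and> (\<forall>i\<in>{1..n}. \<forall>j\<in>{1..n}. i \<noteq> j \<longrightarrow> U i \<omega> \<noteq> U j \<omega>)"
proof -
  have "card ((\<lambda>i. U i \<omega>) ` {1..n}) = n \<longleftrightarrow> inj_on (\<lambda>i. U i \<omega>) {1..n}"
    using inj_on_iff_eq_card[of "{1..n}" "\<lambda>i. U i \<omega>"] by simp
  then show ?thesis
    unfolding nsets_def random_set_def by (auto simp: inj_on_def)
qed

lemma random_set_measurable:
  assumes U: "\<And>i. i \<in> {1..n} \<Longrightarrow> U i \<in> borel_measurable M" and "m \<le> n"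
  shows "random_set U m \<in> proper_space M (random_set U n) B n \<rightarrow>\<^sub>M nsets_algebra B m"
  unfolding nsets_algebra_def
proof (rule measurable_measure_of)
  let ?N = "proper_space M (random_set U n) B n"
  have sub: "random_set U m \<omega> \<in> nsets B m" if "random_set U n \<omega> \<in> nsets B n" for \<omega>
    using that \<open>m \<le> n\<close> by (simp add: random_set_in_nsets_iff)
  have sp: "\<omega> \<in> space M \<and> random_set U n \<omega> \<in> nsets B n" if "\<omega> \<in> space ?N" for \<omega>
    using that by (auto simp: proper_space_def space_restrict_space)
  show "random_set U m \<in> space ?N \<rightarrow> nsets B m"
    using sp sub by blast
  show "{(\<lambda>A. card (A \<inter> C)) -` K \<inter> nsets B m |C K. C \<in> sets borel \<and> C \<subseteq> B} \<subseteq> Pow (nsets B m)"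
    by auto
  fix E assume "E \<in> {(\<lambda>A. card (A \<inter> C)) -` K \<inter> nsets B m |C K. C \<in> sets borel \<and> C \<subseteq> B}"
  then obtain C K where C: "C \<in> sets borel"
    and E: "E = (\<lambda>A. card (A \<inter> C)) -` K \<inter> nsets B m" by auto
  have UN: "U i \<in> borel_measurable ?N" if "i \<in> {1..m}" for i
    unfolding proper_space_def using U that \<open>m \<le> n\<close> by (intro measurable_restrict_space1) auto
  have card_eq: "card (random_set U m \<omega> \<inter> C) = (\<Sum>i\<in>{1..m}. if U i \<omega> \<in> C then 1 else 0)"
    if "\<omega> \<in> space ?N" for \<omega>
  proof -
    have inj: "inj_on (\<lambda>i. U i \<omega>) {1..m}"
      using sub[of \<omega>] sp[OF that] unfolding random_set_in_nsets_iff inj_on_def by blast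
    have "random_set U m \<omega> \<inter> C = (\<lambda>i. U i \<omega>) ` {i\<in>{1..m}. U i \<omega> \<in> C}"
      by (auto simp: random_set_def)
    moreover have "inj_on (\<lambda>i. U i \<omega>) {i\<in>{1..m}. U i \<omega> \<in> C}"
      by (rule inj_on_subset[OF inj]) auto
    ultimately have "card (random_set U m \<omega> \<inter> C) = card {i\<in>{1..m}. U i \<omega> \<in> C}"
      by (simp add: card_image)
    also have "\<dots> = (\<Sum>i\<in>{1..m}. if U i \<omega> \<in> C then 1 else 0)"
      by (simp only: card_eq_sum sum.inter_filter finite_atLeastAtMost)
    finally show ?thesis .
  qed
  have "(\<lambda>\<omega>. if U i \<omega> \<in> C then 1 else (0::nat)) \<in> borel_measurable ?N" if "i \<in> {1..m}" for i
  proof (rule measurable_If)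
    have "U i -` C \<inter> space ?N \<in> sets ?N" by (rule measurable_sets[OF UN[OF that] C])
    also have "U i -` C \<inter> space ?N = {\<omega> \<in> space ?N. U i \<omega> \<in> C}" by auto
    finally show "{\<omega> \<in> space ?N. U i \<omega> \<in> C} \<in> sets ?N" .
  qed simp_all
  then have "(\<lambda>\<omega>. \<Sum>i\<in>{1..m}. if U i \<omega> \<in> C then 1 else (0::nat)) \<in> borel_measurable ?N"
    by (rule borel_measurable_sum)
  then have "(\<lambda>\<omega>. card (random_set U m \<omega> \<inter> C)) \<in> borel_measurable ?N"
    by (rule measurable_cong[THEN iffD2, rotated]) (rule card_eq)
  then have "(\<lambda>\<omega>. card (random_set U m \<omega> \<inter> C)) -` K \<inter> space ?N \<in> sets ?N"
    by (rule measurable_sets) (rule borel_open, rule Topological_Spaces.open_discrete)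
  also have "(\<lambda>\<omega>. card (random_set U m \<omega> \<inter> C)) -` K \<inter> space ?N = random_set U m -` E \<inter> space ?N"
    unfolding E using sp sub by blast
  finally show "random_set U m -` E \<inter> space ?N \<in> sets ?N" .
qed

lemma (in prob_space) indep_uniform_AE_neq:
  fixes X Y :: "'a \<Rightarrow> real"
  assumes "indep_var borel X borel Y"
    and "distr M borel Y = uniform_measure lborel {0..1::real}"
  shows "AE \<omega> in M. X \<omega> \<noteq> Y \<omega>"
proof -
  have X: "X \<in> borel_measurable M" and Y: "Y \<in> borel_measurable M"
    and eq: "distr M borel X \<Otimes>\<^sub>M distr M borel Y = distr M (borel \<Otimes>\<^sub>M borel) (\<lambda>x. (X x, Y x))"
    using assms(1) by (auto simp: indep_var_distribution_eq)
  interpret Y: prob_space "distr M borel Y" by (rule prob_space_distr[OF Y])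
  let ?D = "{p::real\<times>real. fst p = snd p}"
  have D: "?D \<in> sets (borel \<Otimes>\<^sub>M borel)"
    unfolding borel_prod by (intro borel_closed closed_Collect_eq continuous_intros)
  have "emeasure (distr M borel X \<Otimes>\<^sub>M distr M borel Y) ?D
      = (\<integral>\<^sup>+x. emeasure (distr M borel Y) (Pair x -` ?D) \<partial>distr M borel X)"
    by (rule Y.emeasure_pair_measure_alt) (use D in \<open>simp cong: sets_pair_measure_cong\<close>)
  also have "\<dots> = (\<integral>\<^sup>+x. 0 \<partial>distr M borel X)"
  proof (rule nn_integral_cong)
    fix x :: real
    have "emeasure lborel ({0..1} \<inter> {x}) \<le> emeasure lborel {x}"
      by (rule emeasure_mono) auto
    moreover have "Pair x -` ?D = {x}" by auto
    ultimately show "emeasure (distr M borel Y) (Pair x -` ?D) = 0"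
      by (simp add: assms(2))
  qed
  finally have "emeasure (distr M (borel \<Otimes>\<^sub>M borel) (\<lambda>x. (X x, Y x))) ?D = 0"
    by (simp add: eq)
  then have "emeasure M ((\<lambda>x. (X x, Y x)) -` ?D \<inter> space M) = 0"
    using D X Y by (subst (asm) emeasure_distr) auto
  moreover have "(\<lambda>x. (X x, Y x)) -` ?D \<inter> space M \<in> sets M"
    by (rule measurable_sets[OF measurable_Pair[OF X Y] D])
  ultimately show ?thesis
    by (intro AE_I[where N = "(\<lambda>x. (X x, Y x)) -` ?D \<inter> space M"]) auto
qed

lemma (in prob_space) proper_event:
  assumes indep: "indep_vars (\<lambda>_. borel) U {1..n}"
    and unif: "\<And>i. i \<in> {1..n} \<Longrightarrow> distr M borel (U i) = uniform_measure lborel {0..1::real}"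
  shows "AE \<omega> in M. random_set U n \<omega> \<in> nsets {0..1} n"
    and "prob_space (proper_space M (random_set U n) {0..1} n)"
proof -
  have U: "U i \<in> borel_measurable M" if "i \<in> {1..n}" for i
    using indep that by (auto simp: indep_vars_def)
  have in01: "AE \<omega> in M. U i \<omega> \<in> {0..1}" if i: "i \<in> {1..n}" for i
  proof -
    have "AE x in distr M borel (U i). x \<in> {0..1}"
      unfolding unif[OF i] by (rule AE_uniform_measureI) auto
    then show ?thesis by (subst (asm) AE_distr_iff) (use U[OF i] in auto)
  qed
  have neq: "AE \<omega> in M. i \<noteq> j \<longrightarrow> U i \<omega> \<noteq> U j \<omega>" if "i \<in> {1..n}" "j \<in> {1..n}" for i j
  proof (cases "i = j")
    case False
    have "indep_var (PiM {i} (\<lambda>_. borel)) (\<lambda>\<omega>. restrict (\<lambda>k. U k \<omega>) {i})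
        (PiM {j} (\<lambda>_. borel)) (\<lambda>\<omega>. restrict (\<lambda>k. U k \<omega>) {j})"
      by (rule indep_var_restrict[OF indep]) (use that False in auto)
    then have "indep_var borel ((\<lambda>f. f i) \<circ> (\<lambda>\<omega>. restrict (\<lambda>k. U k \<omega>) {i}))
        borel ((\<lambda>f. f j) \<circ> (\<lambda>\<omega>. restrict (\<lambda>k. U k \<omega>) {j}))"
      by (rule indep_var_compose) (auto intro!: measurable_component_singleton)
    then have "indep_var borel (U i) borel (U j)"
      by (simp add: comp_def)
    from indep_uniform_AE_neq[OF this unif[OF that(2)]] show ?thesis by auto
  qed simp
  show AE: "AE \<omega> in M. random_set U n \<omega> \<in> nsets {0..1} n"
    unfolding random_set_in_nsets_iff AE_conj_iff
    using in01 neq by (auto simp: AE_finite_all simp del: atLeastAtMost_iff)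
  have "{\<omega> \<in> space M. U i \<omega> \<in> {0..1}} \<in> events" if "i \<in> {1..n}" for i
  proof -
    have "U i -` {0..1} \<inter> space M \<in> events"
      by (rule measurable_sets[OF U[OF that]]) simp
    also have "U i -` {0..1} \<inter> space M = {\<omega> \<in> space M. U i \<omega> \<in> {0..1}}" by auto
    finally show ?thesis .
  qed
  moreover have "{\<omega> \<in> space M. i \<noteq> j \<longrightarrow> U i \<omega> \<noteq> U j \<omega>} \<in> events"
    if "i \<in> {1..n}" "j \<in> {1..n}" for i j
    using borel_measurable_neq[OF U[OF that(1)] U[OF that(2)]] by (cases "i = j") auto
  ultimately have "{\<omega> \<in> space M. random_set U n \<omega> \<in> nsets {0..1} n} \<in> events"
    unfolding random_set_in_nsets_iff
    by (intro sets.sets_Collect_conj sets.sets_Collect_finite_All finite_atLeastAtMost)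
  with AE show "prob_space (proper_space M (random_set U n) {0..1} n)"
    unfolding proper_space_def
    by (intro prob_space_restrict_space emeasure_eq_1_AE) auto
qed

end

theory Submission
  imports Defs
begin

text \<open>
  Call the level of a finite set \<open>A\<close> the least \<open>k\<close> for which the points of \<open>A\<close> lie in distinct
  dyadic cells of side \<open>2\<^sup>-\<^sup>k\<close>, and its phase the fractional part of \<open>2\<^sup>k\<close> times the sum of \<open>A\<close>.
  Fix \<open>n - 1\<close> points \<open>Y\<close> and add a uniform point \<open>z\<close>. The level \<open>k\<close> and the rank of \<open>z\<close> in the new set
  depend only on the dyadic cell of \<open>z\<close> at level \<open>k\<close>, while the phase is a rotation of the position
  of \<open>z\<close> inside that cell; so the phase is uniform and independent of the rank.
  Delete from an \<open>n\<close>-set the point whose rank is \<open>\<lfloor>n \<cdot> phase\<rfloor>\<close>, and keep \<open>frac (n \<cdot> phase)\<close> as the extra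
  randomness \<open>v\<close>. Whatever \<open>Y\<close> is, the event that \<open>z\<close> is deleted and \<open>v \<in> B\<close> then has probability
  \<open>|B| / n\<close>. Hence deleting each \<open>U\<^sub>i\<close> contributes \<open>|B| / n\<close> times the law of the other \<open>n - 1\<close> points, and
  the \<open>n\<close> contributions are equal by exchangeability.
\<close>

section \<open>Cells and rotations under the uniform law\<close>

lemma borel_measurable_frac [measurable]: "(frac :: real \<Rightarrow> real) \<in> borel_measurable borel"
  unfolding frac_def[abs_def] by measurable

text \<open>The endpoint 1 is a null set. The half-open interval is preferred because it splits
  exactly into cells on which \<open>\<lfloor>m * z\<rfloor>\<close> is constant.\<close>

lemma emeasure_uniform_01:
  assumes "S \<in> sets borel"
  shows "emeasure (uniform_measure lborel {0..1::real}) S = emeasure lborel (S \<inter> {0..<1})"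
proof -
  have "emeasure lborel ({0..1} \<inter> S) = emeasure lborel (S \<inter> {0..<1})"
  proof (rule emeasure_eq_AE)
    have "AE x in lborel. x \<noteq> (1::real)" by (rule AE_lborel_singleton)
    then show "AE x in lborel. x \<in> {0..1} \<inter> S \<longleftrightarrow> x \<in> S \<inter> {0..<1}" by eventually_elim auto
  qed (use assms in auto)
  then show ?thesis using assms by (simp add: divide_ennreal_def)
qed

text \<open>Rotations of the circle preserve Lebesgue measure. With \<open>d = frac c\<close>, the
  rotation translates \<open>{0..<1 - d}\<close> by \<open>d\<close> onto \<open>{d..<1}\<close> and
  \<open>{1 - d..<1}\<close> by \<open>d - 1\<close> onto \<open>{0..<d}\<close>.\<close>

lemma emeasure_frac_shift:
  assumes [measurable]: "J \<in> sets borel"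
  shows "emeasure lborel ({w::real. frac (w + c) \<in> J} \<inter> {0..<1}) = emeasure lborel (J \<inter> {0..<1})"
proof -
  define d where "d = frac c"
  have d: "0 \<le> d" "d < 1" by (auto simp: d_def frac_lt_1)
  have fr: "frac (w + c) = (if w < 1 - d then w + d else w + d - 1)" if "0 \<le> w" "w < 1" for w
  proof -
    have "frac w = w" using that by (simp add: frac_eq)
    then show ?thesis unfolding frac_add d_def by auto
  qed
  have shift: "emeasure lborel {w. w + t \<in> S} = emeasure lborel S" if "S \<in> sets borel" for S and t :: real
  proof -
    have "emeasure lborel S = emeasure (distr lborel borel ((+) t)) S"
      by (simp add: lborel_distr_plus)
    also have "\<dots> = emeasure lborel {w. w + t \<in> S}"
      using that by (subst emeasure_distr) (auto simp: vimage_def add.commute)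
    finally show ?thesis ..
  qed
  have "emeasure lborel (J \<inter> {0..<1}) = emeasure lborel (J \<inter> {d..<1} \<union> J \<inter> {0..<d})"
    using d by (intro arg_cong[where f="emeasure lborel"]) auto
  also have "\<dots> = emeasure lborel (J \<inter> {d..<1}) + emeasure lborel (J \<inter> {0..<d})"
    by (rule plus_emeasure[symmetric]) auto
  also have "\<dots> = emeasure lborel {w. w + d \<in> J \<inter> {d..<1}} + emeasure lborel {w. w + (d - 1) \<in> J \<inter> {0..<d}}"
    using shift[of "J \<inter> {d..<1}" d] shift[of "J \<inter> {0..<d}" "d - 1"] by simp
  also have "\<dots> = emeasure lborel ({w. w + d \<in> J \<inter> {d..<1}} \<union> {w. w + (d - 1) \<in> J \<inter> {0..<d}})"
    by (rule plus_emeasure) auto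
  also have "{w. w + d \<in> J \<inter> {d..<1}} \<union> {w. w + (d - 1) \<in> J \<inter> {0..<d}} = {w. frac (w + c) \<in> J} \<inter> {0..<1}"
    using d by (auto simp: fr algebra_simps split: if_splits)
  finally show ?thesis ..
qed

text \<open>The substitution \<open>z = (i + w) / m\<close> maps \<open>{0..<1}\<close> onto the
  cell with index \<open>i\<close> and contributes the factor \<open>1 / m\<close>. In the variable
  \<open>w\<close> the fractional part is a rotation by \<open>c\<close>, which preserves
  measure.\<close>

lemma emeasure_cell:
  fixes m :: real
  assumes "m > 0" and [measurable]: "J \<in> sets borel"
  shows "emeasure lborel {z. \<lfloor>m * z\<rfloor> = i \<and> frac (m * z + c) \<in> J} = ennreal (1 / m) * emeasure lborel (J \<inter> {0..<1})"
proof -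
  have meas: "{z. \<lfloor>m * z\<rfloor> = i \<and> frac (m * z + c) \<in> J} \<in> sets borel"
  proof -
    have "{z \<in> space borel. \<lfloor>m * z\<rfloor> = i \<and> frac (m * z + c) \<in> J} \<in> sets borel"
      by measurable
    then show ?thesis by simp
  qed
  have "emeasure lborel {z. \<lfloor>m * z\<rfloor> = i \<and> frac (m * z + c) \<in> J}
      = (\<integral>\<^sup>+z. indicator {z. \<lfloor>m * z\<rfloor> = i \<and> frac (m * z + c) \<in> J} z \<partial>lborel)"
    by (subst nn_integral_indicator) (simp_all add: meas)
  also have "\<dots> = ennreal \<bar>1 / m\<bar> * (\<integral>\<^sup>+w. indicator {z. \<lfloor>m * z\<rfloor> = i \<and> frac (m * z + c) \<in> J} (i / m + 1 / m * w) \<partial>lborel)"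
    by (rule nn_integral_real_affine) (use assms meas in auto)
  also have "(\<integral>\<^sup>+w. indicator {z. \<lfloor>m * z\<rfloor> = i \<and> frac (m * z + c) \<in> J} (i / m + 1 / m * w) \<partial>lborel)
     = (\<integral>\<^sup>+w. indicator ({w. frac (w + c) \<in> J} \<inter> {0..<1}) w \<partial>lborel)"
  proof (rule nn_integral_cong)
    fix w :: real
    have m: "m * (i / m + 1 / m * w) = i + w" using assms by (simp add: field_simps)
    have "frac (of_int i + w + c) = frac (w + c)"
      by (simp add: frac_def add.assoc)
    moreover have "\<lfloor>of_int i + w\<rfloor> = i \<longleftrightarrow> w \<in> {0..<1}" by (auto simp: floor_eq_iff)
    ultimately show "indicator {z. \<lfloor>m * z\<rfloor> = i \<and> frac (m * z + c) \<in> J} (i / m + 1 / m * w)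
       = (indicator ({w. frac (w + c) \<in> J} \<inter> {0..<1}) w :: ennreal)"
      unfolding indicator_def mem_Collect_eq m Int_iff by auto
  qed
  also have "\<dots> = emeasure lborel (J \<inter> {0..<1})"
    by (subst nn_integral_indicator) (auto simp: emeasure_frac_shift)
  finally show ?thesis using assms by simp
qed

text \<open>Every cell contributes \<open>1 / m\<close> times the measure of \<open>J\<close>, by
  \<open>emeasure_cell\<close>, so only the number of admissible indices matters.\<close>

lemma emeasure_uniform_floor_frac:
  fixes m :: nat and c :: real
  assumes "m > 0" and J[measurable]: "J \<in> sets borel"
  defines "u \<equiv> uniform_measure lborel {0..1::real}"
  shows "emeasure u {z. P \<lfloor>m * z\<rfloor> \<and> frac (m * z + c) \<in> J}
      = ennreal (card {i\<in>{0..<int m}. P i} / m) * emeasure u J"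
proof -
  let ?D = "\<lambda>i. {z::real. \<lfloor>m * z\<rfloor> = i \<and> frac (m * z + c) \<in> J}"
  let ?I = "{i\<in>{0..<int m}. P i}"
  have meas: "{z::real. Q \<lfloor>m * z\<rfloor> \<and> frac (m * z + c) \<in> J} \<in> sets borel" for Q
  proof -
    have "{z \<in> space borel. Q \<lfloor>real m * z\<rfloor> \<and> frac (real m * z + c) \<in> J} \<in> sets borel"
      by measurable
    then show ?thesis by simp
  qed
  \<comment> \<open>As \<open>m\<close> is a positive integer, the cells with indices 0 to
    \<open>m - 1\<close> tile \<open>{0..<1}\<close> exactly.\<close>
  have "z \<in> {0..<1} \<longleftrightarrow> \<lfloor>m * z\<rfloor> \<in> {0..<int m}" for z :: real
    using assms(1) by (auto simp: floor_less_iff le_floor_iff zero_le_mult_iff)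
  then have eq: "{z. P \<lfloor>m * z\<rfloor> \<and> frac (m * z + c) \<in> J} \<inter> {0..<1} = (\<Union>i\<in>?I. ?D i)"
    by blast
  have "emeasure u {z. P \<lfloor>m * z\<rfloor> \<and> frac (m * z + c) \<in> J} = emeasure lborel (\<Union>i\<in>?I. ?D i)"
    unfolding u_def emeasure_uniform_01[OF meas] eq ..
  also have "\<dots> = (\<Sum>i\<in>?I. emeasure lborel (?D i))"
  proof (rule sum_emeasure[symmetric])
    show "?D ` ?I \<subseteq> sets lborel" using meas by fastforce
    show "disjoint_family_on ?D ?I" unfolding disjoint_family_on_def by blast
    show "finite ?I" by (rule finite_subset[of _ "{0..<int m}"]) auto
  qed
  also have "\<dots> = (\<Sum>i\<in>?I. ennreal (1 / m) * emeasure u J)"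
    unfolding u_def emeasure_uniform_01[OF J]
    by (intro sum.cong refl emeasure_cell) (use assms in simp_all)
  also have "\<dots> = (ennreal (card ?I) * ennreal (1 / m)) * emeasure u J"
    by (simp only: sum_constant ennreal_of_nat_eq_real_of_nat mult.assoc)
  also have "ennreal (card ?I) * ennreal (1 / m) = ennreal (card ?I / m)"
    by (subst ennreal_mult[symmetric]) simp_all
  finally show ?thesis .
qed

text \<open>The case \<open>J = UNIV\<close> identifies the counting factor as the probability of
  the event on the cell index. Hence the cell index and the rotated position inside the cell are
  independent.\<close>

lemma emeasure_uniform_floor_frac_indep:
  fixes m :: nat and c :: real
  assumes "m > 0" and [measurable]: "J \<in> sets borel"
  defines "u \<equiv> uniform_measure lborel {0..1::real}"
  shows "emeasure u {z. P \<lfloor>m * z\<rfloor> \<and> frac (m * z + c) \<in> J} = emeasure u {z. P \<lfloor>m * z\<rfloor>} * emeasure u J"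
proof -
  have "emeasure u UNIV = 1" by (simp add: u_def emeasure_uniform_01)
  then show ?thesis
    using emeasure_uniform_floor_frac[OF assms(1), of UNIV P c] emeasure_uniform_floor_frac[OF assms(1,2), of P c]
    by (simp add: u_def)
qed

section \<open>Ranks, dyadic levels and the thinning map\<close>

text \<open>In a strictly sorted list the entries below the one at index \<open>k\<close> are
  exactly the \<open>k\<close> earlier ones, so index and rank, both counted from 0,
  coincide.\<close>

lemma nth_sorted_list_of_set_eq_iff:
  assumes "finite A" "j < card A" "x \<in> A"
  shows "sorted_list_of_set A ! j = x \<longleftrightarrow> card {a\<in>A. a < x} = j"
proof -
  let ?xs = "sorted_list_of_set A"
  have len: "length ?xs = card A" by simp
  have sw: "sorted_wrt (<) ?xs" by (rule strict_sorted_list_of_set)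
  have less: "?xs ! i < ?xs ! k \<longleftrightarrow> i < k" if "i < card A" "k < card A" for i k
    using sorted_wrt_nth_less[OF sw, of i k] sorted_wrt_nth_less[OF sw, of k i] that len
    by (metis less_asym linorder_neqE_nat)
  have card: "card {a\<in>A. a < ?xs ! k} = k" if k: "k < card A" for k
  proof -
    have "{a\<in>A. a < ?xs ! k} = (!) ?xs ` {..<k}"
    proof (intro set_eqI)
      fix a
      have "a \<in> A \<longleftrightarrow> (\<exists>i<card A. a = ?xs ! i)"
        using assms(1) len by (metis in_set_conv_nth set_sorted_list_of_set)
      then have "a \<in> A \<and> a < ?xs ! k \<longleftrightarrow> (\<exists>i<card A. a = ?xs ! i \<and> i < k)"
        using less[OF _ k] by metis
      also have "\<dots> \<longleftrightarrow> (\<exists>i<k. a = ?xs ! i)"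
        using k by (metis order.strict_trans)
      finally show "a \<in> {a\<in>A. a < ?xs ! k} \<longleftrightarrow> a \<in> (!) ?xs ` {..<k}" by auto
    qed
    moreover have "inj_on ((!) ?xs) {..<k}"
      using len k by (intro inj_on_nth) auto
    ultimately show ?thesis by (simp add: card_image)
  qed
  obtain k where "k < card A" "x = ?xs ! k"
    using assms(1,3) len by (metis in_set_conv_nth set_sorted_list_of_set)
  then show ?thesis using card assms(2) by metis
qed

definition level :: "real set \<Rightarrow> nat" where
  "level A = (LEAST k. inj_on (\<lambda>x. \<lfloor>2 ^ k * x\<rfloor>) A)"

definition phase :: "real set \<Rightarrow> real" where
  "phase A = frac (2 ^ level A * \<Sum>A)"

definition chosen :: "real set \<Rightarrow> real" where
  "chosen A = sorted_list_of_set A ! nat \<lfloor>card A * phase A\<rfloor>"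

definition thinning :: "real set \<Rightarrow> real set" where
  "thinning A = A - {chosen A}"

text \<open>If the phase is uniform, \<open>\<lfloor>card A * phase A\<rfloor>\<close> and this
  fractional part are independent and both uniform. One phase thus supplies the deleted rank and
  leaves a fresh uniform variable.\<close>

definition residue :: "real set \<Rightarrow> real" where
  "residue A = frac (card A * phase A)"

text \<open>Dyadic cells are nested: the index of the coarser cell is the index of the finer one
  divided by \<open>2 ^ (k - l)\<close>.\<close>

lemma floor_pow2_mono:
  fixes x y :: real
  assumes "l \<le> k" "\<lfloor>2 ^ k * x\<rfloor> = \<lfloor>2 ^ k * y\<rfloor>"
  shows "\<lfloor>2 ^ l * x\<rfloor> = \<lfloor>2 ^ l * y\<rfloor>"
proof -
  have "\<lfloor>2 ^ l * z\<rfloor> = \<lfloor>2 ^ k * z\<rfloor> div 2 ^ (k - l)" for z :: real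
  proof -
    have "2 ^ l * z = 2 ^ k * z / of_int (2 ^ (k - l))"
    proof -
      have "(2::real) ^ k = 2 ^ l * 2 ^ (k - l)" by (metis assms(1) le_add_diff_inverse power_add)
      then show ?thesis by simp
    qed
    then show ?thesis by (simp only: floor_divide_real_eq_div zero_le_power zero_le_numeral)
  qed
  with assms(2) show ?thesis by simp
qed

text \<open>The \<open>LEAST\<close> in \<open>level\<close> is attained. Two distinct points are
  separated at some level, and by nesting at all finer ones; the maximum over the finitely many
  pairs separates all of \<open>A\<close>.\<close>

lemma inj_on_floor_level:
  assumes "finite A"
  shows "inj_on (\<lambda>x. \<lfloor>2 ^ level A * x\<rfloor>) A"
proof -
  have "\<exists>k. \<lfloor>2 ^ k * x\<rfloor> \<noteq> \<lfloor>2 ^ k * y\<rfloor>" if "x < y" for x y :: real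
  proof -
    obtain k where "1 / (y - x) < 2 ^ k"
      using real_arch_pow[of 2 "1 / (y - x)"] by auto
    then have "1 < 2 ^ k * y - 2 ^ k * x" using that by (simp add: field_simps)
    then show ?thesis by (intro exI[of _ k]) linarith
  qed
  then have "\<exists>k. x \<noteq> y \<longrightarrow> \<lfloor>2 ^ k * x\<rfloor> \<noteq> \<lfloor>2 ^ k * y\<rfloor>" for x y :: real
    by (metis linorder_neqE_linordered_idom)
  then obtain f where f: "\<And>x y :: real. x \<noteq> y \<Longrightarrow> \<lfloor>2 ^ f x y * x\<rfloor> \<noteq> \<lfloor>2 ^ f x y * y\<rfloor>"
    by metis
  obtain k where k: "\<And>x y. x \<in> A \<Longrightarrow> y \<in> A \<Longrightarrow> f x y \<le> k"
  proof -
    have "finite ((\<lambda>(x, y). f x y) ` (A \<times> A))" using assms by simp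
    then obtain k where "\<forall>l\<in>(\<lambda>(x, y). f x y) ` (A \<times> A). l \<le> k"
      by (meson finite_nat_set_iff_bounded_le)
    then show thesis by (intro that) auto
  qed
  have "inj_on (\<lambda>x. \<lfloor>2 ^ k * x\<rfloor>) A"
  proof (rule inj_onI, rule ccontr)
    fix x y assume "x \<in> A" "y \<in> A" "\<lfloor>2 ^ k * x\<rfloor> = \<lfloor>2 ^ k * y\<rfloor>" "x \<noteq> y"
    with f[of x y] floor_pow2_mono[OF k] show False by blast
  qed
  then show ?thesis unfolding level_def by (rule LeastI)
qed

lemma phase_bounds: "0 \<le> phase A" "phase A < 1"
  by (simp_all add: phase_def frac_lt_1)

text \<open>These bounds make the list access in \<open>chosen\<close> legitimate.\<close>

lemma card_phase_bounds:
  assumes "finite A" "A \<noteq> {}"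
  shows "0 \<le> \<lfloor>card A * phase A\<rfloor>" "nat \<lfloor>card A * phase A\<rfloor> < card A"
proof -
  have c: "card A > 0" using assms by (simp add: card_gt_0_iff)
  then show "0 \<le> \<lfloor>card A * phase A\<rfloor>" by (simp add: phase_bounds)
  have "card A * phase A < card A"
    using mult_strict_left_mono[OF phase_bounds(2), of "real (card A)" A] c by simp
  then show "nat \<lfloor>card A * phase A\<rfloor> < card A"
    using c by (simp add: nat_less_iff floor_less_iff phase_bounds)
qed

lemma chosen_in:
  assumes "finite A" "A \<noteq> {}"
  shows "chosen A \<in> A"
  using card_phase_bounds(2)[OF assms] assms(1)
  by (metis chosen_def length_sorted_list_of_set nth_mem set_sorted_list_of_set)

text \<open>The sorted list is replaced by the rank of \<open>x\<close>, which is constant on dyadic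
  cells, and a condition on the phase.\<close>

lemma chosen_eq_iff:
  assumes "finite A" "x \<in> A"
  shows "chosen A = x \<longleftrightarrow> \<lfloor>card A * phase A\<rfloor> = int (card {a\<in>A. a < x})"
proof -
  have ne: "A \<noteq> {}" using assms(2) by auto
  show ?thesis
    unfolding chosen_def nth_sorted_list_of_set_eq_iff[OF assms(1) card_phase_bounds(2)[OF assms(1) ne] assms(2)]
    using card_phase_bounds(1)[OF assms(1) ne] by auto
qed

text \<open>At level \<open>k\<close> the cell of \<open>x\<close> contains no point of
  \<open>Y\<close>. A point \<open>x'\<close> of that cell shares the cell of \<open>x\<close> at
  every coarser level too, so it collides with points of \<open>Y\<close> at the same levels up to
  \<open>k\<close>, and it lies on the same side of each of them.\<close>

lemma level_insert_cong:
  assumes "finite Y" and x: "x \<notin> Y" "level (insert x Y) = k" and eq: "\<lfloor>2 ^ k * x\<rfloor> = \<lfloor>2 ^ k * x'\<rfloor>"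
  shows "x' \<notin> Y" "level (insert x' Y) = k" "card {a\<in>Y. a < x'} = card {a\<in>Y. a < x}"
proof -
  have inj: "inj_on (\<lambda>x. \<lfloor>2 ^ k * x\<rfloor>) (insert x Y)"
    using inj_on_floor_level[of "insert x Y"] assms by simp
  then have ne: "\<lfloor>2 ^ k * a\<rfloor> \<noteq> \<lfloor>2 ^ k * x\<rfloor>" if "a \<in> Y" for a
    using x(1) that by (auto simp: inj_on_def)
  show x': "x' \<notin> Y" using ne eq by metis
  have iff: "inj_on (\<lambda>x. \<lfloor>2 ^ l * x\<rfloor>) (insert x' Y) \<longleftrightarrow> inj_on (\<lambda>x. \<lfloor>2 ^ l * x\<rfloor>) (insert x Y)"
    if "l \<le> k" for l
    using x x' floor_pow2_mono[OF that eq] by (simp add: inj_on_insert)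
  have "level (insert x' Y) \<le> k"
    unfolding level_def by (rule Least_le) (use iff[of k] inj in simp)
  \<comment> \<open>The bound just obtained permits the use of \<open>iff\<close> at
    \<open>level (insert x' Y)\<close> itself, which carries injectivity back to
    \<open>insert x Y\<close>.\<close>
  moreover from this have "level (insert x Y) \<le> level (insert x' Y)"
    using iff inj_on_floor_level[of "insert x' Y"] assms(1)
    by (subst level_def) (rule Least_le, simp)
  ultimately show "level (insert x' Y) = k" using x by simp
  \<comment> \<open>Points in different cells are ordered as their cells are, so the rank depends on
    the cell alone.\<close>
  have "a < x \<longleftrightarrow> \<lfloor>2 ^ k * a\<rfloor> < \<lfloor>2 ^ k * x\<rfloor>" if "\<lfloor>2 ^ k * a\<rfloor> \<noteq> \<lfloor>2 ^ k * x\<rfloor>" for a x :: real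
    using that floor_mono[of "2 ^ k * a" "2 ^ k * x"] floor_mono[of "2 ^ k * x" "2 ^ k * a"]
    by (smt (verit) mult_le_cancel_left_pos zero_less_power)
  with ne eq have "a < x' \<longleftrightarrow> a < x" if "a \<in> Y" for a
    using that by metis
  then show "card {a\<in>Y. a < x'} = card {a\<in>Y. a < x}"
    by (intro arg_cong[where f=card]) auto
qed

section \<open>Adding one uniform point to a fixed finite set\<close>

lemma emeasure_uniform_Compl_finite:
  fixes Y :: "real set"
  assumes "finite Y"
  shows "emeasure (uniform_measure lborel {0..1}) (- Y) = 1"
proof -
  have Y: "Y \<in> null_sets lborel" using assms by (rule finite_imp_null_set_lborel)
  have "emeasure lborel ({0..<1} - Y) = emeasure lborel {0..<1::real}"
    using Y by (intro emeasure_Diff_null_set) auto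
  moreover have "- Y \<inter> {0..<1} = {0..<1} - Y" by auto
  moreover have "- Y \<in> sets borel" using Y by (auto simp: null_sets_def)
  ultimately show ?thesis by (simp add: emeasure_uniform_01 del: emeasure_uniform_measure)
qed

text \<open>The complement of \<open>Y\<close> has full measure and is partitioned into the sets
  \<open>R (k, j)\<close> of points producing level \<open>k\<close> and rank \<open>j\<close>. Each
  is a union of cells of level \<open>k\<close>, and on it the event is a condition on the phase
  alone. By independence of cell and phase, the event has conditional probability
  \<open>1 / n\<close> times the measure of \<open>B\<close> on every piece of positive measure,
  whatever \<open>k\<close> and \<open>j\<close> are.\<close>

lemma emeasure_uniform_chosen:
  fixes Y :: "real set"
  defines "u \<equiv> uniform_measure lborel {0..1::real}"
  assumes fin: "finite Y" and B: "B \<in> sets borel"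
  shows "{x. x \<notin> Y \<and> chosen (insert x Y) = x \<and> residue (insert x Y) \<in> B} \<in> sets borel" (is "?W \<in> _")
    and "emeasure u {x. x \<notin> Y \<and> chosen (insert x Y) = x \<and> residue (insert x Y) \<in> B}
      = ennreal (1 / Suc (card Y)) * emeasure u B"
proof -
  define n where "n = Suc (card Y)"
  define R where "R = (\<lambda>(k, j). {x. x \<notin> Y \<and> level (insert x Y) = k \<and> card {a\<in>Y. a < x} = j})"
  \<comment> \<open>These are the phases that select rank \<open>j\<close> and leave a residue in
    \<open>B\<close>.\<close>
  define J where "J j = {s. \<lfloor>real n * s\<rfloor> = int j \<and> frac (real n * s) \<in> B}" for j :: nat
  \<comment> \<open>\<open>Q p\<close> holds for the indices of the cells that meet
    \<open>R p\<close>; by \<open>R_iff\<close> such a cell lies entirely in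
    \<open>R p\<close>.\<close>
  define Q where "Q p i \<longleftrightarrow> (\<exists>x\<in>R p. \<lfloor>2 ^ fst p * x\<rfloor> = i)" for p :: "nat \<times> nat" and i :: int
  define X where "X p = {x. Q p \<lfloor>real (2 ^ fst p) * x\<rfloor> \<and> frac (real (2 ^ fst p) * x + 2 ^ fst p * \<Sum>Y) \<in> J (snd p)}"
    for p :: "nat \<times> nat"
  let ?I = "UNIV \<times> {..<n} :: (nat \<times> nat) set"
  have u: "sets u = sets borel" by (simp add: u_def)
  have R_iff: "x \<in> R p \<longleftrightarrow> Q p \<lfloor>real (2 ^ fst p) * x\<rfloor>" for x p
  proof
    assume "Q p \<lfloor>real (2 ^ fst p) * x\<rfloor>"
    then obtain x0 where "x0 \<in> R p" "\<lfloor>2 ^ fst p * x0\<rfloor> = \<lfloor>2 ^ fst p * x\<rfloor>"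
      by (auto simp: Q_def)
    then show "x \<in> R p"
      using level_insert_cong[OF fin, of x0 "fst p" x] by (auto simp: R_def split: prod.splits)
  qed (auto simp: Q_def)
  have J_sets[measurable]: "J j \<in> sets borel" for j
  proof -
    have "{s \<in> space borel. \<lfloor>real n * s\<rfloor> = int j \<and> frac (real n * s) \<in> B} \<in> sets borel"
      using B by measurable
    then show ?thesis by (simp add: J_def)
  qed
  have cells: "{x. Q p \<lfloor>real m * x\<rfloor> \<and> frac (real m * x + c) \<in> S} \<in> sets borel"
    if [measurable]: "S \<in> sets borel" for p m c S
  proof -
    have "{x \<in> space borel. Q p \<lfloor>real m * x\<rfloor> \<and> frac (real m * x + c) \<in> S} \<in> sets borel"
      by measurable
    then show ?thesis by simp
  qed
  have X_sets: "X p \<in> sets borel" for p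
    unfolding X_def by (rule cells) simp
  have R_eq: "R p = {x. Q p \<lfloor>real (2 ^ fst p) * x\<rfloor>}" for p
    using R_iff by blast
  have R_sets: "R p \<in> sets borel" for p
    using cells[of UNIV p "2 ^ fst p"] by (simp add: R_eq)
  have X_R: "X p \<subseteq> R p" for p
    unfolding X_def R_eq by auto
  have disj: "disjoint_family_on R ?I"
    by (auto simp: disjoint_family_on_def R_def)
  have UN_R: "(\<Union>p\<in>?I. R p) = - Y"
  proof -
    have "card {a\<in>Y. a < x} < n" for x
      unfolding n_def using card_mono[OF fin, of "{a\<in>Y. a < x}"] by auto
    then show ?thesis by (auto simp: R_def)
  qed
  have W_iff: "x \<in> ?W \<longleftrightarrow> x \<in> X p" if "x \<in> R p" for x p
  proof -
    obtain k j where p: "p = (k, j)" by fastforce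
    have x: "x \<notin> Y" "level (insert x Y) = k" "card {a\<in>Y. a < x} = j"
      using that by (auto simp: p R_def)
    have "{a \<in> insert x Y. a < x} = {a\<in>Y. a < x}" by auto
    \<comment> \<open>On \<open>R p\<close> the level is fixed, so the new point enters the phase
      linearly and \<open>Y\<close> contributes only a constant shift.\<close>
    moreover have "phase (insert x Y) = frac (2 ^ k * x + 2 ^ k * \<Sum>Y)"
      using x fin by (simp add: phase_def distrib_left)
    moreover have "card (insert x Y) = n"
      using x fin by (simp add: n_def)
    ultimately show ?thesis
      using that x fin R_iff[of x p] chosen_eq_iff[of "insert x Y" x]
      by (simp add: X_def J_def residue_def p)
  qed
  have UN_X: "(\<Union>p\<in>?I. X p) = ?W"
  proof
    show "(\<Union>p\<in>?I. X p) \<subseteq> ?W" using W_iff X_R by blast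
    show "?W \<subseteq> (\<Union>p\<in>?I. X p)"
    proof
      fix x assume W: "x \<in> ?W"
      then have "x \<in> - Y" by simp
      then obtain p where "p \<in> ?I" "x \<in> R p" unfolding UN_R[symmetric] by blast
      with W W_iff show "x \<in> (\<Union>p\<in>?I. X p)" by blast
    qed
  qed
  show "?W \<in> sets borel"
    unfolding UN_X[symmetric] using X_sets by (intro sets.countable_UN') auto
  \<comment> \<open>This is the case of \<open>n\<close> cells, shift 0 and the single admissible
    index \<open>j\<close>.\<close>
  have J: "emeasure u (J j) = ennreal (1 / n) * emeasure u B" if "j < n" for j
  proof -
    have "{i \<in> {0..<int n}. i = int j} = {int j}" using that by auto
    then show ?thesis
      using emeasure_uniform_floor_frac[of n B "\<lambda>i. i = int j" 0] B
      by (simp add: J_def u_def n_def)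
  qed
  \<comment> \<open>The level is unbounded, so the pieces form a countable family, summed as an
    integral over a counting measure.\<close>
  have "emeasure u ?W = (\<integral>\<^sup>+p. emeasure u (X p) \<partial>count_space ?I)"
    unfolding UN_X[symmetric]
  proof (rule emeasure_UN_countable)
    show "disjoint_family_on X ?I"
      using disj X_R unfolding disjoint_family_on_def by blast
  qed (simp_all add: u X_sets)
  also have "\<dots> = (\<integral>\<^sup>+p. emeasure u (R p) * (ennreal (1 / n) * emeasure u B) \<partial>count_space ?I)"
  proof (rule nn_integral_cong)
    fix p assume "p \<in> space (count_space ?I)"
    then have "snd p < n" by auto
    moreover have "emeasure u (X p) = emeasure u (R p) * emeasure u (J (snd p))"
      unfolding X_def R_eq u_def by (intro emeasure_uniform_floor_frac_indep) auto
    ultimately show "emeasure u (X p) = emeasure u (R p) * (ennreal (1 / n) * emeasure u B)"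
      by (simp add: J)
  qed
  also have "\<dots> = (\<integral>\<^sup>+p. emeasure u (R p) \<partial>count_space ?I) * (ennreal (1 / n) * emeasure u B)"
    by (rule nn_integral_multc) simp
  also have "(\<integral>\<^sup>+p. emeasure u (R p) \<partial>count_space ?I) = emeasure u (- Y)"
    unfolding UN_R[symmetric] using R_sets disj
    by (intro emeasure_UN_countable[symmetric]) (auto simp: u)
  also have "emeasure u (- Y) = 1"
    unfolding u_def by (rule emeasure_uniform_Compl_finite[OF fin])
  finally show "emeasure u ?W = ennreal (1 / Suc (card Y)) * emeasure u B"
    by (simp add: n_def)
qed

section \<open>Measurability for the counting sigma-algebra\<close>

text \<open>The generators use only \<open>C \<subseteq> B\<close>. Members of
  \<open>nsets B n\<close> lie in \<open>B\<close>, so replacing \<open>C\<close> by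
  \<open>C \<inter> B\<close> changes no count.\<close>

lemma measurable_card_Int:
  assumes "B \<in> sets borel" "C \<in> sets borel"
  shows "(\<lambda>A. card (A \<inter> C)) \<in> nsets_algebra B n \<rightarrow>\<^sub>M count_space UNIV"
proof (rule measurableI)
  fix K :: "nat set"
  let ?G = "{(\<lambda>A. card (A \<inter> C)) -` K \<inter> nsets B n | C K. C \<in> sets borel \<and> C \<subseteq> B}"
  have "card (A \<inter> (C \<inter> B)) = card (A \<inter> C)" if "A \<in> nsets B n" for A
    using that by (intro arg_cong[where f = card]) (auto simp: nsets_def)
  then have "(\<lambda>A. card (A \<inter> C)) -` K \<inter> nsets B n = (\<lambda>A. card (A \<inter> (C \<inter> B))) -` K \<inter> nsets B n"
    by auto
  also have "\<dots> \<in> ?G"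
    using assms by blast
  finally have "(\<lambda>A. card (A \<inter> C)) -` K \<inter> nsets B n \<in> ?G" .
  moreover have "?G \<subseteq> Pow (nsets B n)" by auto
  ultimately show "(\<lambda>A. card (A \<inter> C)) -` K \<inter> space (nsets_algebra B n) \<in> sets (nsets_algebra B n)"
    unfolding nsets_algebra_def by (simp add: in_measure_of space_measure_of)
qed simp

text \<open>Order statistics are expressed through the counts that generate the sigma-algebra; their
  measurability follows.\<close>

lemma nth_sorted_list_of_set_le_iff:
  fixes y :: real
  assumes "finite A" "j < card A"
  shows "sorted_list_of_set A ! j \<le> y \<longleftrightarrow> j < card (A \<inter> {..y})"
proof -
  let ?x = "sorted_list_of_set A ! j"
  have xA: "?x \<in> A"
    using assms by (metis length_sorted_list_of_set nth_mem set_sorted_list_of_set)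
  then have card: "card {a\<in>A. a < ?x} = j"
    using nth_sorted_list_of_set_eq_iff[OF assms] by blast
  show ?thesis
  proof
    assume "?x \<le> y"
    then have "insert ?x {a\<in>A. a < ?x} \<subseteq> A \<inter> {..y}" using xA by auto
    then have "card (insert ?x {a\<in>A. a < ?x}) \<le> card (A \<inter> {..y})"
      using assms by (intro card_mono) auto
    then show "j < card (A \<inter> {..y})" using card assms by simp
  next
    assume less: "j < card (A \<inter> {..y})"
    show "?x \<le> y"
    proof (rule ccontr)
      assume "\<not> ?x \<le> y"
      then have "A \<inter> {..y} \<subseteq> {a\<in>A. a < ?x}" by auto
      then have "card (A \<inter> {..y}) \<le> j"
        using assms by (subst card[symmetric]) (intro card_mono, auto)
      with less show False by simp
    qed
  qed
qed

lemma measurable_nth_sorted_list_of_set: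
  assumes "B \<in> sets borel" "j < n"
  shows "(\<lambda>A. sorted_list_of_set A ! j) \<in> borel_measurable (nsets_algebra B n)"
proof (rule borel_measurableI_le)
  fix y :: real
  have "(\<lambda>A. card (A \<inter> {..y})) -` {j<..} \<inter> space (nsets_algebra B n) \<in> sets (nsets_algebra B n)"
    by (rule measurable_sets[OF measurable_card_Int]) (use assms in auto)
  also have "(\<lambda>A. card (A \<inter> {..y})) -` {j<..} \<inter> space (nsets_algebra B n)
    = {A \<in> space (nsets_algebra B n). sorted_list_of_set A ! j \<le> y}"
    using assms nth_sorted_list_of_set_le_iff by (auto simp: nsets_def)
  finally show "{A \<in> space (nsets_algebra B n). sorted_list_of_set A ! j \<le> y} \<in> sets (nsets_algebra B n)" .
qed

lemma bij_betw_nth_sorted_list_of_set: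
  assumes "finite A"
  shows "bij_betw ((!) (sorted_list_of_set A)) {..<card A} A"
  using bij_betw_nth[of "sorted_list_of_set A" "{..<card A}" A] assms by simp

text \<open>Injectivity on \<open>A\<close> becomes a finite conjunction over pairs of order
  statistics, which are measurable functions of \<open>A\<close>.\<close>

lemma measurable_level:
  assumes B: "B \<in> sets borel"
  shows "level \<in> nsets_algebra B n \<rightarrow>\<^sub>M count_space UNIV"
proof -
  let ?P = "\<lambda>k A. \<forall>i\<in>{..<n}. \<forall>j\<in>{..<n}. \<lfloor>2 ^ k * sorted_list_of_set A ! i\<rfloor> = \<lfloor>2 ^ k * sorted_list_of_set A ! j\<rfloor> \<longrightarrow> i = j"
  have [measurable]: "(\<lambda>A. sorted_list_of_set A ! j) \<in> borel_measurable (nsets_algebra B n)" if "j \<in> {..<n}" for j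
    using that B by (intro measurable_nth_sorted_list_of_set) auto
  have "(\<lambda>A. LEAST k. ?P k A) \<in> nsets_algebra B n \<rightarrow>\<^sub>M count_space UNIV"
    by measurable
  also have "?this \<longleftrightarrow> ?thesis"
  proof (rule measurable_cong)
    fix A assume "A \<in> space (nsets_algebra B n)"
    then have A: "finite A" "card A = n" by (auto simp: nsets_def)
    have bij: "bij_betw ((!) (sorted_list_of_set A)) {..<n} A"
      using bij_betw_nth_sorted_list_of_set[OF A(1)] A(2) by simp
    have "?P k A \<longleftrightarrow> inj_on (\<lambda>x. \<lfloor>2 ^ k * x\<rfloor>) A" for k
    proof -
      have "inj_on ((\<lambda>x. \<lfloor>2 ^ k * x\<rfloor>) \<circ> (!) (sorted_list_of_set A)) {..<n} \<longleftrightarrow> inj_on (\<lambda>x. \<lfloor>2 ^ k * x\<rfloor>) A"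
        using comp_inj_on_iff[of "(!) (sorted_list_of_set A)" "{..<n}"] bij by (auto simp: bij_betw_def)
      then show ?thesis by (simp add: inj_on_def)
    qed
    then show "(LEAST k. ?P k A) = level A" by (simp only: level_def)
  qed
  finally show ?thesis .
qed

lemma measurable_phase:
  assumes B: "B \<in> sets borel"
  shows "phase \<in> borel_measurable (nsets_algebra B n)"
proof -
  have [measurable]: "(\<lambda>A. sorted_list_of_set A ! j) \<in> borel_measurable (nsets_algebra B n)" if "j \<in> {..<n}" for j
    using that B by (intro measurable_nth_sorted_list_of_set) auto
  note measurable_level[OF B, measurable]
  have "(\<lambda>A. frac (2 ^ level A * (\<Sum>j\<in>{..<n}. sorted_list_of_set A ! j))) \<in> borel_measurable (nsets_algebra B n)"
    by measurable
  also have "?this \<longleftrightarrow> ?thesis"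
  proof (rule measurable_cong)
    fix A assume "A \<in> space (nsets_algebra B n)"
    then have "bij_betw ((!) (sorted_list_of_set A)) {..<n} A"
      using bij_betw_nth_sorted_list_of_set[of A] by (auto simp: nsets_def)
    from sum.reindex_bij_betw[OF this, of "\<lambda>x. x"]
    show "frac (2 ^ level A * (\<Sum>j\<in>{..<n}. sorted_list_of_set A ! j)) = phase A"
      by (simp add: phase_def)
  qed
  finally show ?thesis .
qed

lemma measurable_residue:
  assumes "B \<in> sets borel"
  shows "residue \<in> borel_measurable (nsets_algebra B n)"
proof -
  note measurable_phase[OF assms, measurable]
  have "(\<lambda>A. frac (real n * phase A)) \<in> borel_measurable (nsets_algebra B n)"
    by measurable
  also have "?this \<longleftrightarrow> ?thesis"
    by (rule measurable_cong) (auto simp: residue_def nsets_def)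
  finally show ?thesis .
qed

lemma measurable_chosen:
  assumes B: "B \<in> sets borel" and n: "n \<ge> 1"
  shows "chosen \<in> borel_measurable (nsets_algebra B n)"
proof -
  have [measurable]: "(\<lambda>A. sorted_list_of_set A ! j) \<in> borel_measurable (nsets_algebra B n)" if "j \<in> {..<n}" for j
    using that B by (intro measurable_nth_sorted_list_of_set) auto
  note measurable_phase[OF assms(1), measurable]
  \<comment> \<open>List access at a random index is written as a finite sum in which only the
    selected index survives.\<close>
  have "(\<lambda>A. \<Sum>j\<in>{..<n}. if \<lfloor>real n * phase A\<rfloor> = int j then sorted_list_of_set A ! j else 0)
      \<in> borel_measurable (nsets_algebra B n)"
    by measurable
  also have "?this \<longleftrightarrow> ?thesis"
  proof (rule measurable_cong)
    fix A assume "A \<in> space (nsets_algebra B n)"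
    then have A: "finite A" "card A = n" "A \<noteq> {}" using n by (auto simp: nsets_def)
    have "(\<Sum>j\<in>{..<n}. if \<lfloor>real n * phase A\<rfloor> = int j then sorted_list_of_set A ! j else 0)
      = (\<Sum>j\<in>{..<n}. if nat \<lfloor>real n * phase A\<rfloor> = j then sorted_list_of_set A ! j else 0)"
      using card_phase_bounds(1)[OF A(1,3)] A(2) by (intro sum.cong) auto
    also have "\<dots> = chosen A"
      using card_phase_bounds(2)[OF A(1,3)] A(2) by (simp add: chosen_def)
    finally show "(\<Sum>j\<in>{..<n}. if \<lfloor>real n * phase A\<rfloor> = int j then sorted_list_of_set A ! j else 0) = chosen A" .
  qed
  finally show ?thesis .
qed

text \<open>Deleting the chosen point lowers the count in \<open>C\<close> by one exactly when that
  point lies in \<open>C\<close>, so the generating counts pull back to measurable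
  functions.\<close>

lemma measurable_thinning:
  assumes B: "B \<in> sets borel" and n: "n \<ge> 1"
  shows "thinning \<in> nsets_algebra B n \<rightarrow>\<^sub>M nsets_algebra B (n - 1)"
  unfolding nsets_algebra_def[of B "n - 1"]
proof (rule measurable_measure_of)
  let ?G = "{(\<lambda>A. card (A \<inter> C)) -` K \<inter> nsets B (n - 1) | C K. C \<in> sets borel \<and> C \<subseteq> B}"
  show "?G \<subseteq> Pow (nsets B (n - 1))" by auto
  have chosen: "chosen A \<in> A" if "A \<in> nsets B n" for A
    using that n by (intro chosen_in) (auto simp: nsets_def)
  then show maps: "thinning \<in> space (nsets_algebra B n) \<rightarrow> nsets B (n - 1)"
    by (auto simp: thinning_def nsets_def)
  fix E assume "E \<in> ?G"
  then obtain C K where C[measurable]: "C \<in> sets borel"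
    and E: "E = (\<lambda>A. card (A \<inter> C)) -` K \<inter> nsets B (n - 1)" by auto
  note measurable_card_Int[OF B C, measurable] measurable_chosen[OF B n, measurable]
  have eq: "card (thinning A \<inter> C) = card (A \<inter> C) - (if chosen A \<in> C then 1 else 0)"
    if "A \<in> nsets B n" for A
  proof -
    have "thinning A \<inter> C = (A \<inter> C) - {chosen A}" by (auto simp: thinning_def)
    then show ?thesis using chosen[OF that] by (simp add: card_Diff_singleton_if)
  qed
  have "(\<lambda>A. card (A \<inter> C) - (if chosen A \<in> C then 1 else 0)) \<in> nsets_algebra B n \<rightarrow>\<^sub>M count_space UNIV"
    by measurable
  from measurable_sets[OF this, of K]
  have "(\<lambda>A. card (A \<inter> C) - (if chosen A \<in> C then 1 else 0)) -` K \<inter> nsets B n \<in> sets (nsets_algebra B n)"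
    by simp
  also have "(\<lambda>A. card (A \<inter> C) - (if chosen A \<in> C then 1 else 0)) -` K \<inter> nsets B n
    = thinning -` E \<inter> space (nsets_algebra B n)"
    using maps eq unfolding E by auto
  finally show "thinning -` E \<inter> space (nsets_algebra B n) \<in> sets (nsets_algebra B n)" .
qed

section \<open>Independent uniform coordinates on the product space\<close>

lemma sets_random_set_in_nsets:
  assumes U: "\<And>i. i \<in> {1..n} \<Longrightarrow> U i \<in> borel_measurable M" and B: "B \<in> sets borel"
  shows "{\<omega> \<in> space M. random_set U n \<omega> \<in> nsets B n} \<in> sets M"
proof -
  note U[measurable] B[measurable]
  show ?thesis unfolding random_set_in_nsets_iff by measurable
qed

lemma sets_proper_space:
  assumes "{\<omega> \<in> space M. X \<omega> \<in> nsets B n} \<in> sets M" "S \<in> sets (proper_space M X B n)"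
  shows "S \<in> sets M" "emeasure (proper_space M X B n) S = emeasure M S"
proof -
  let ?S = "{\<omega> \<in> space M. X \<omega> \<in> nsets B n}"
  have S: "?S \<inter> space M \<in> sets M"
    using assms(1) by (simp add: Int_absorb2)
  then show "S \<in> sets M" using assms(2)
    by (simp add: proper_space_def sets_restrict_space_iff)
  have "S \<subseteq> ?S"
    using sets.sets_into_space[OF assms(2)] by (auto simp: proper_space_def space_restrict_space)
  then show "emeasure (proper_space M X B n) S = emeasure M S"
    unfolding proper_space_def by (rule emeasure_restrict_space[OF S])
qed

text \<open>The product space is the model in which a single coordinate can be integrated out and
  coordinates can be permuted. The event on thinning and residue is split into the
  \<open>H E B i\<close> according to the deleted coordinate, and each is compared with
  \<open>G E\<close>, where the first \<open>n - 1\<close> coordinates form the set.\<close>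

context
  fixes n :: nat and u :: "real measure" and \<Omega> :: "(nat \<Rightarrow> real) measure"
    and N :: "(nat \<Rightarrow> real) measure" and X :: "nat \<Rightarrow> (nat \<Rightarrow> real) \<Rightarrow> real set"
    and H :: "real set set \<Rightarrow> real set \<Rightarrow> nat \<Rightarrow> (nat \<Rightarrow> real) set"
    and G :: "real set set \<Rightarrow> (nat \<Rightarrow> real) set"
  defines "u \<equiv> uniform_measure lborel {0..1::real}"
    and "\<Omega> \<equiv> PiM {1..n} (\<lambda>_. u)"
    and "X \<equiv> random_set (\<lambda>i \<omega>. \<omega> i)"
    and "N \<equiv> proper_space \<Omega> (X n) {0..1} n"
    and "H \<equiv> \<lambda>E B i. {\<omega> \<in> space N. chosen (X n \<omega>) = \<omega> i \<and> thinning (X n \<omega>) \<in> E \<and> residue (X n \<omega>) \<in> B}"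
    and "G \<equiv> \<lambda>E. {\<omega> \<in> space N. X (n - 1) \<omega> \<in> E}"
  assumes n: "n \<ge> 1"
begin

lemma sets_u: "sets u = sets borel"
  by (simp add: u_def)

lemma prob_space_u: "prob_space u"
  unfolding u_def by (rule prob_space_uniform_measure) auto

lemma coordinate_measurable: "i \<in> {1..n} \<Longrightarrow> (\<lambda>\<omega>. \<omega> i) \<in> borel_measurable \<Omega>"
  using measurable_component_singleton[of i "{1..n}" "\<lambda>_. u"] sets_u
  by (simp add: \<Omega>_def cong: measurable_cong_sets)

lemma sets_proper: "{\<omega> \<in> space \<Omega>. X n \<omega> \<in> nsets {0..1} n} \<in> sets \<Omega>"
  unfolding X_def by (rule sets_random_set_in_nsets) (auto intro: coordinate_measurable)

lemma space_N: "space N = {\<omega> \<in> space \<Omega>. X n \<omega> \<in> nsets {0..1} n}"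
  by (auto simp: N_def proper_space_def space_restrict_space)

lemma X_measurable: "m \<le> n \<Longrightarrow> X m \<in> N \<rightarrow>\<^sub>M nsets_algebra {0..1} m"
  unfolding N_def X_def by (rule random_set_measurable) (auto intro: coordinate_measurable)

lemma sets_H:
  assumes E: "E \<in> sets (nsets_algebra {0..1} (n - 1))" and B: "B \<in> sets borel" and i: "i \<in> {1..n}"
  shows "H E B i \<in> sets N"
proof -
  have "{\<omega> \<in> space N. c \<omega> = d \<omega> \<and> t \<omega> \<in> E \<and> r \<omega> \<in> B} \<in> sets N"
    if [measurable]: "c \<in> borel_measurable N" "d \<in> borel_measurable N" "r \<in> borel_measurable N"
      "t \<in> N \<rightarrow>\<^sub>M nsets_algebra {0..1} (n - 1)" for c d r :: "(nat \<Rightarrow> real) \<Rightarrow> real" and t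
  proof -
    note E[measurable] B[measurable]
    show ?thesis
      by (intro sets.sets_Collect_conj borel_measurable_eq) measurable
  qed
  moreover have "(\<lambda>\<omega>. chosen (X n \<omega>)) \<in> borel_measurable N"
    by (rule measurable_compose[OF X_measurable measurable_chosen]) (use n in auto)
  moreover have "(\<lambda>\<omega>. thinning (X n \<omega>)) \<in> N \<rightarrow>\<^sub>M nsets_algebra {0..1} (n - 1)"
    by (rule measurable_compose[OF X_measurable measurable_thinning]) (use n in auto)
  moreover have "(\<lambda>\<omega>. residue (X n \<omega>)) \<in> borel_measurable N"
    by (rule measurable_compose[OF X_measurable measurable_residue]) auto
  moreover have "(\<lambda>\<omega>. \<omega> i) \<in> borel_measurable N"
    unfolding N_def proper_space_def by (intro measurable_restrict_space1 coordinate_measurable i)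
  ultimately show ?thesis unfolding H_def by blast
qed

lemma sets_G:
  assumes E: "E \<in> sets (nsets_algebra {0..1} (n - 1))"
  shows "G E \<in> sets N"
proof -
  have [measurable]: "X (n - 1) \<in> N \<rightarrow>\<^sub>M nsets_algebra {0..1} (n - 1)"
    by (rule X_measurable) simp
  note E[measurable]
  show ?thesis unfolding G_def by measurable
qed

lemma sets_N_imp: "S \<in> sets N \<Longrightarrow> S \<in> sets \<Omega> \<and> emeasure N S = emeasure \<Omega> S"
  unfolding N_def using sets_proper_space[OF sets_proper] by blast

text \<open>
  Integrating out the last coordinate suffices: the event \<open>H E B i\<close> is carried to \<open>H E B n\<close> by the
  transposition of \<open>i\<close> and \<open>n\<close>.
\<close>

lemma emeasure_H_last:
  assumes E: "E \<in> sets (nsets_algebra {0..1} (n - 1))" and B: "B \<in> sets borel"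
  shows "emeasure \<Omega> (H E B n) = ennreal (1 / n) * emeasure u B * emeasure \<Omega> (G E)"
proof -
  let ?I = "{1..n - 1}"
  let ?c = "ennreal (1 / n) * emeasure u B"
  interpret u: prob_space u by (rule prob_space_u)
  interpret product_sigma_finite "\<lambda>_. u" by unfold_locales
  have I: "insert n ?I = {1..n}" "n \<notin> ?I" "finite ?I" using n by auto
  have \<Omega>: "\<Omega> = PiM (insert n ?I) (\<lambda>_. u)" by (simp only: \<Omega>_def I(1))
  have H: "H E B n \<in> sets \<Omega>" and G: "G E \<in> sets \<Omega>"
    using sets_N_imp sets_H[OF E B] sets_G[OF E] n by auto
  \<comment> \<open>With the first \<open>n - 1\<close> coordinates fixed, both sides are
    probabilities for the last coordinate alone: if \<open>Y \<in> E\<close>, the left one is given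
    by \<open>emeasure_uniform_chosen\<close> and the right one is \<open>?c\<close>; otherwise both
    vanish.\<close>
  have inner: "(\<integral>\<^sup>+z. indicator (H E B n) (y(n := z)) \<partial>u) = (\<integral>\<^sup>+z. ?c * indicator (G E) (y(n := z)) \<partial>u)"
    if y: "y \<in> space (PiM ?I (\<lambda>_. u))" for y
  proof -
    define Y where "Y = y ` ?I"
    have finY: "finite Y" by (simp add: Y_def)
    \<comment> \<open>Since \<open>Y\<close> has at most \<open>n - 1\<close> points,
      \<open>insert z Y\<close> can have \<open>n\<close> points only if no two coordinates
      coincide.\<close>
    have "card Y \<le> n - 1" using card_image_le[of ?I y] by (simp add: Y_def)
    then have nsets: "insert z Y \<in> nsets {0..1} n \<longleftrightarrow> Y \<in> nsets {0..1} (n - 1) \<and> z \<notin> Y \<and> z \<in> {0..1}" for z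
      using finY n by (auto simp: nsets_def card_insert_if)
    have ins: "y(n := z) ` {1..n} = insert z Y" for z
      unfolding I(1)[symmetric] Y_def using I(2) by auto
    have Xn: "X n (y(n := z)) = insert z Y" for z
      using ins by (simp add: X_def random_set_def)
    have Xn1: "X (n - Suc 0) (y(n := z)) = Y" for z
      using I(2) by (auto simp: X_def random_set_def Y_def)
    have sp: "y(n := z) \<in> space \<Omega>" for z
      using y I by (auto simp: \<Omega>_def space_PiM u_def PiE_def extensional_def)
    show ?thesis
    proof (cases "Y \<in> E")
      case True
      then have Yn: "Y \<in> nsets {0..1} (n - 1)"
        using sets.sets_into_space[OF E] by auto
      then have cY: "Suc (card Y) = n" using n by (auto simp: nsets_def)
      define W where "W = {x. x \<notin> Y \<and> chosen (insert x Y) = x \<and> residue (insert x Y) \<in> B}"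
      have W: "W \<in> sets borel" "emeasure u W = ?c"
        using emeasure_uniform_chosen[OF finY B] unfolding W_def u_def cY by auto
      \<comment> \<open>When the new point is the chosen one, thinning returns \<open>Y\<close>, so
        membership in \<open>E\<close> no longer involves \<open>z\<close>. The intersection with
        \<open>{0..1}\<close> comes from the space of \<open>N\<close> and costs no measure under
        \<open>u\<close>.\<close>
      have "y(n := z) \<in> H E B n \<longleftrightarrow> z \<in> {0..1} \<inter> W" for z
        using True Yn by (auto simp: H_def space_N sp Xn nsets W_def thinning_def)
      moreover have "y(n := z) \<in> G E \<longleftrightarrow> z \<in> {0..1} \<inter> (- Y)" for z
        using True Yn by (auto simp: G_def space_N sp Xn Xn1 nsets)
      ultimately have "(\<integral>\<^sup>+z. indicator (H E B n) (y(n := z)) \<partial>u) = (\<integral>\<^sup>+z. indicator ({0..1} \<inter> W) z \<partial>u)"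
          "(\<integral>\<^sup>+z. ?c * indicator (G E) (y(n := z)) \<partial>u) = (\<integral>\<^sup>+z. ?c * indicator ({0..1} \<inter> (- Y)) z \<partial>u)"
        by (simp_all add: indicator_def)
      moreover have "emeasure u ({0..1} \<inter> S) = emeasure u S" if "S \<in> sets borel" for S
        using that by (simp add: u_def Int_assoc[symmetric])
      moreover have "- Y \<in> sets borel" using finY by (simp add: finite_imp_closed borel_open open_Compl)
      moreover have "emeasure u (- Y) = 1" unfolding u_def by (rule emeasure_uniform_Compl_finite[OF finY])
      ultimately show ?thesis
        using W by (simp add: nn_integral_cmult_indicator sets_u)
    next
      case False
      then have "y(n := z) \<notin> H E B n" "y(n := z) \<notin> G E" for z
        by (auto simp: H_def G_def space_N Xn Xn1 nsets thinning_def)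
      then show ?thesis by simp
    qed
  qed
  have "emeasure \<Omega> (H E B n) = (\<integral>\<^sup>+\<omega>. indicator (H E B n) \<omega> \<partial>\<Omega>)"
    using H by simp
  also have "\<dots> = (\<integral>\<^sup>+y. \<integral>\<^sup>+z. indicator (H E B n) (y(n := z)) \<partial>u \<partial>PiM ?I (\<lambda>_. u))"
    unfolding \<Omega>
    by (intro product_nn_integral_insert I borel_measurable_indicator H[unfolded \<Omega>])
  also have "\<dots> = (\<integral>\<^sup>+y. \<integral>\<^sup>+z. ?c * indicator (G E) (y(n := z)) \<partial>u \<partial>PiM ?I (\<lambda>_. u))"
    by (rule nn_integral_cong) (rule inner)
  also have "\<dots> = (\<integral>\<^sup>+\<omega>. ?c * indicator (G E) \<omega> \<partial>\<Omega>)"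
    unfolding \<Omega>
    by (intro product_nn_integral_insert[symmetric] I borel_measurable_times_ennreal borel_measurable_const
        borel_measurable_indicator G[unfolded \<Omega>])
  also have "\<dots> = ?c * emeasure \<Omega> (G E)"
    using G by (simp add: nn_integral_cmult)
  finally show ?thesis .
qed

lemma emeasure_H:
  assumes E: "E \<in> sets (nsets_algebra {0..1} (n - 1))" and B: "B \<in> sets borel" and i: "i \<in> {1..n}"
  shows "emeasure \<Omega> (H E B i) = emeasure \<Omega> (H E B n)"
proof -
  define \<tau> where "\<tau> = Transposition.transpose i n"
  define T :: "(nat \<Rightarrow> real) \<Rightarrow> nat \<Rightarrow> real" where "T \<omega> = (\<lambda>k\<in>{1..n}. \<omega> (\<tau> k))" for \<omega>
  have img: "\<tau> ` {1..n} = {1..n}" and inj: "inj_on \<tau> {1..n}"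
    using i n by (auto simp: \<tau>_def intro: inj_on_subset[OF inj_transpose])
  have \<tau>_in: "\<tau> k \<in> {1..n}" if "k \<in> {1..n}" for k
    using img that by auto
  \<comment> \<open>All factors are equal, so permuting the coordinates preserves the product
    measure.\<close>
  have distr: "distr \<Omega> \<Omega> T = \<Omega>"
    unfolding \<Omega>_def T_def
    by (rule distr_PiM_reindex[where M = "\<lambda>_. u"]) (use inj img prob_space_u in auto)
  have T: "T \<in> \<Omega> \<rightarrow>\<^sub>M \<Omega>"
    unfolding \<Omega>_def T_def
    by (rule measurable_restrict) (rule measurable_component_singleton, rule \<tau>_in)
  \<comment> \<open>The unordered set does not see the permutation; only the label of the deleted
    coordinate moves from \<open>i\<close> to \<open>n\<close>.\<close>
  have X: "X n (T \<omega>) = X n \<omega>" for \<omega>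
  proof -
    have "T \<omega> ` {1..n} = (\<lambda>k. \<omega> (\<tau> k)) ` {1..n}" by (simp add: T_def)
    also have "\<dots> = \<omega> ` \<tau> ` {1..n}" by (simp only: image_image)
    finally show ?thesis by (simp only: X_def random_set_def img)
  qed
  have Tn: "T \<omega> n = \<omega> i" for \<omega> using n by (simp add: T_def \<tau>_def)
  have "T \<omega> \<in> space \<Omega>" if "\<omega> \<in> space \<Omega>" for \<omega> using measurable_space[OF T that] .
  then have pre: "T -` H E B n \<inter> space \<Omega> = H E B i"
    by (auto simp: H_def space_N X Tn)
  have "H E B n \<in> sets \<Omega>" using sets_N_imp sets_H[OF E B] n by auto
  then have "emeasure (distr \<Omega> \<Omega> T) (H E B n) = emeasure \<Omega> (H E B i)"
    using T by (simp add: emeasure_distr pre)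
  then show ?thesis by (simp add: distr)
qed

text \<open>On the proper event the coordinates are distinct, so the chosen point is exactly one of
  them and the \<open>H E B i\<close> are disjoint. Their \<open>n\<close> equal measures cancel the
  factor \<open>1 / n\<close>.\<close>

lemma emeasure_thinning_residue_PiM:
  assumes E: "E \<in> sets (nsets_algebra {0..1} (n - 1))" and B: "B \<in> sets borel"
  shows "{\<omega> \<in> space \<Omega>. X n \<omega> \<in> nsets {0..1} n \<and> thinning (X n \<omega>) \<in> E \<and> residue (X n \<omega>) \<in> B} \<in> sets \<Omega>"
      (is "?S \<in> _")
    and "{\<omega> \<in> space \<Omega>. X n \<omega> \<in> nsets {0..1} n \<and> X (n - 1) \<omega> \<in> E} \<in> sets \<Omega>" (is "?S' \<in> _")
    and "emeasure \<Omega> {\<omega> \<in> space \<Omega>. X n \<omega> \<in> nsets {0..1} n \<and> thinning (X n \<omega>) \<in> E \<and> residue (X n \<omega>) \<in> B}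
      = emeasure u B * emeasure \<Omega> {\<omega> \<in> space \<Omega>. X n \<omega> \<in> nsets {0..1} n \<and> X (n - 1) \<omega> \<in> E}"
proof -
  have S: "?S = (\<Union>i\<in>{1..n}. H E B i)"
  proof -
    have "\<exists>i\<in>{1..n}. chosen (X n \<omega>) = \<omega> i" if "X n \<omega> \<in> nsets {0..1} n" for \<omega>
    proof -
      have "chosen (X n \<omega>) \<in> X n \<omega>"
        using that n by (intro chosen_in) (auto simp: nsets_def)
      then show ?thesis by (auto simp: X_def random_set_def)
    qed
    then show ?thesis unfolding H_def space_N by blast
  qed
  have S': "?S' = G E" by (auto simp: G_def space_N)
  have H: "H E B i \<in> sets \<Omega>" if "i \<in> {1..n}" for i
    using sets_N_imp sets_H[OF E B that] by auto
  show "?S \<in> sets \<Omega>" unfolding S using H by (intro sets.finite_UN) auto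
  show "?S' \<in> sets \<Omega>" unfolding S' using sets_N_imp sets_G[OF E] by auto
  have "disjoint_family_on (H E B) {1..n}"
    unfolding disjoint_family_on_def H_def space_N X_def random_set_in_nsets_iff by auto
  then have "emeasure \<Omega> ?S = (\<Sum>i\<in>{1..n}. emeasure \<Omega> (H E B i))"
    unfolding S using H by (intro sum_emeasure[symmetric]) auto
  also have "\<dots> = (\<Sum>i\<in>{1..n}. ennreal (1 / n) * emeasure u B * emeasure \<Omega> (G E))"
    using emeasure_H[OF E B] emeasure_H_last[OF E B] by (intro sum.cong) auto
  also have "\<dots> = (ennreal n * ennreal (1 / n)) * emeasure u B * emeasure \<Omega> (G E)"
    by (simp add: ennreal_of_nat_eq_real_of_nat mult.assoc)
  also have "ennreal n * ennreal (1 / n) = 1"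
    using n by (subst ennreal_mult[symmetric]) auto
  finally show "emeasure \<Omega> ?S = emeasure u B * emeasure \<Omega> ?S'" unfolding S' by simp
qed

end

section \<open>Transfer to arbitrary independent uniform variables\<close>

text \<open>Independence says that the joint law of the variables is the product measure. All events
  involved are preimages of events of the product space under the joint map
  \<open>T\<close>.\<close>

lemma (in prob_space) emeasure_thinning_residue:
  fixes U :: "nat \<Rightarrow> 'a \<Rightarrow> real"
  assumes n: "n \<ge> 1"
    and indep: "indep_vars (\<lambda>_. borel) U {1..n}"
    and unif: "\<And>i. i \<in> {1..n} \<Longrightarrow> distr M borel (U i) = uniform_measure lborel {0..1}"
    and E: "E \<in> sets (nsets_algebra {0..1} (n - 1))" and B: "B \<in> sets borel"
  defines "N \<equiv> proper_space M (random_set U n) {0..1} n"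
  shows "emeasure N {\<omega> \<in> space N. thinning (random_set U n \<omega>) \<in> E \<and> residue (random_set U n \<omega>) \<in> B}
    = emeasure (uniform_measure lborel {0..1}) B * emeasure N {\<omega> \<in> space N. random_set U (n - 1) \<omega> \<in> E}"
proof -
  let ?\<Omega> = "PiM {1..n} (\<lambda>_. uniform_measure lborel {0..1::real})"
  let ?X = "random_set (\<lambda>i \<omega>. \<omega> i)"
  define T where "T \<omega> = (\<lambda>i\<in>{1..n}. U i \<omega>)" for \<omega>
  have U: "U i \<in> borel_measurable M" if "i \<in> {1..n}" for i
    using indep that by (auto simp: indep_vars_def)
  have sets: "sets (PiM {1..n} (\<lambda>_. borel)) = sets ?\<Omega>"
    by (rule sets_PiM_cong) auto
  have "distr M (PiM {1..n} (\<lambda>_. borel)) T = PiM {1..n} (\<lambda>i. distr M borel (U i))"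
    unfolding T_def[abs_def] using indep_vars_iff_distr_eq_PiM'[where I = "{1..n}" and M' = "\<lambda>_. borel" and X = U] n U indep by auto
  also have "\<dots> = ?\<Omega>" using unif by (intro PiM_cong) auto
  finally have distr: "distr M ?\<Omega> T = ?\<Omega>"
    using sets by (simp cong: distr_cong)
  have T: "T \<in> M \<rightarrow>\<^sub>M ?\<Omega>"
    unfolding T_def[abs_def] using U by (intro measurable_restrict) (simp cong: measurable_cong_sets)
  have em: "emeasure ?\<Omega> S = emeasure M (T -` S \<inter> space M)" if "S \<in> sets ?\<Omega>" for S
    using T that by (subst distr[symmetric]) (simp add: emeasure_distr)
  have X: "?X m (T \<omega>) = random_set U m \<omega>" if "m \<le> n" for m \<omega>
    using that by (auto simp: random_set_def T_def)
  have space: "T \<omega> \<in> space ?\<Omega>" if "\<omega> \<in> space M" for \<omega>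
    using measurable_space[OF T that] .
  have sN: "space N = {\<omega> \<in> space M. random_set U n \<omega> \<in> nsets {0..1} n}"
    by (auto simp: N_def proper_space_def space_restrict_space)
  have eN: "emeasure N S = emeasure M S" if "S \<subseteq> space N" for S
    unfolding N_def proper_space_def
  proof (rule emeasure_restrict_space)
    show "{\<omega> \<in> space M. random_set U n \<omega> \<in> nsets {0..1} n} \<inter> space M \<in> events"
      using sets_random_set_in_nsets[of n U M "{0..1}"] U by (simp add: Int_absorb2)
  qed (use that sN in auto)
  note PiM = emeasure_thinning_residue_PiM[OF n E B]
  let ?S = "{\<omega> \<in> space ?\<Omega>. ?X n \<omega> \<in> nsets {0..1} n \<and> thinning (?X n \<omega>) \<in> E \<and> residue (?X n \<omega>) \<in> B}"
  let ?S' = "{\<omega> \<in> space ?\<Omega>. ?X n \<omega> \<in> nsets {0..1} n \<and> ?X (n - 1) \<omega> \<in> E}"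
  have "T -` ?S \<inter> space M = {\<omega> \<in> space N. thinning (random_set U n \<omega>) \<in> E \<and> residue (random_set U n \<omega>) \<in> B}"
    using space by (auto simp: X sN)
  moreover have "T -` ?S' \<inter> space M = {\<omega> \<in> space N. random_set U (n - 1) \<omega> \<in> E}"
    using space by (auto simp: X sN)
  ultimately show ?thesis
    using PiM(3) em[OF PiM(1)] em[OF PiM(2)] by (simp add: eN)
qed

theorem proposition5:
  fixes M :: "'a measure" and U :: "nat \<Rightarrow> 'a \<Rightarrow> real" and n :: nat
  assumes "prob_space M"
    and "n \<ge> 1"
    and "prob_space.indep_vars M (\<lambda>_. borel) U {1..n}"
    and "\<And>i. i \<in> {1..n} \<Longrightarrow> distr M borel (U i) = uniform_measure lborel {0..1}"
  defines "N \<equiv> proper_space M (random_set U n) {0..1} n"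
  shows "\<exists>g :: real set \<Rightarrow> real set. g \<in> nsets_algebra {0..1} n \<rightarrow>\<^sub>M nsets_algebra {0..1} (n - 1)
           \<and> (\<forall>A \<in> nsets {0..1} n. g A \<subseteq> A)
           \<and> distr N (nsets_algebra {0..1} (n - 1)) (\<lambda>\<omega>. g (random_set U n \<omega>))
             = distr N (nsets_algebra {0..1} (n - 1)) (random_set U (n - 1))
           \<and> (\<exists>v :: real set \<Rightarrow> real. v \<in> nsets_algebra {0..1} n \<rightarrow>\<^sub>M restrict_space borel {0..1}
                \<and> distr N borel (\<lambda>\<omega>. v (random_set U n \<omega>)) = uniform_measure lborel {0..1}
                \<and> indep_rv N (nsets_algebra {0..1} (n - 1)) (\<lambda>\<omega>. g (random_set U n \<omega>))
                    borel (\<lambda>\<omega>. v (random_set U n \<omega>)))"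
proof -
  interpret prob_space M by fact
  interpret N: prob_space N
    unfolding N_def by (rule proper_event(2)) (use assms in auto)
  let ?S = "nsets_algebra {0..1} (n - 1)"
  let ?u = "uniform_measure lborel {0..1::real}"
  let ?g = "\<lambda>\<omega>. thinning (random_set U n \<omega>)" and ?v = "\<lambda>\<omega>. residue (random_set U n \<omega>)"
  \<comment> \<open>All probabilistic claims follow from this identity: \<open>B = UNIV\<close>
    gives the law of the thinned set, \<open>E\<close> equal to the whole space gives the law of the
    residue, and the product form then gives independence.\<close>
  have joint: "emeasure N {\<omega> \<in> space N. ?g \<omega> \<in> E \<and> ?v \<omega> \<in> B}
      = emeasure ?u B * emeasure N {\<omega> \<in> space N. random_set U (n - 1) \<omega> \<in> E}"
    if "E \<in> sets ?S" "B \<in> sets borel" for E B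
    unfolding N_def by (rule emeasure_thinning_residue) (use assms that in auto)
  have U: "U i \<in> borel_measurable M" if "i \<in> {1..n}" for i
    using assms(3) that by (auto simp: indep_vars_def)
  have X: "random_set U m \<in> N \<rightarrow>\<^sub>M nsets_algebra {0..1} m" if "m \<le> n" for m
    unfolding N_def by (rule random_set_measurable[OF U that])
  have thin: "thinning \<in> nsets_algebra {0..1} n \<rightarrow>\<^sub>M ?S"
    by (rule measurable_thinning) (use assms in auto)
  have g: "?g \<in> N \<rightarrow>\<^sub>M ?S"
    by (rule measurable_compose[OF X thin]) simp
  have v: "?v \<in> borel_measurable N"
    by (rule measurable_compose[OF X measurable_residue]) auto
  have X': "random_set U (n - 1) \<in> N \<rightarrow>\<^sub>M ?S" by (rule X) simp
  have u1: "emeasure ?u UNIV = 1" by (simp add: emeasure_uniform_01)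
  have g_eq: "emeasure N {\<omega> \<in> space N. ?g \<omega> \<in> E} = emeasure N {\<omega> \<in> space N. random_set U (n - 1) \<omega> \<in> E}"
    if "E \<in> sets ?S" for E
    using joint[OF that, of UNIV] u1 by simp
  have v_eq: "emeasure N {\<omega> \<in> space N. ?v \<omega> \<in> B} = emeasure ?u B" if "B \<in> sets borel" for B
  proof -
    have "{\<omega> \<in> space N. ?g \<omega> \<in> space ?S \<and> ?v \<omega> \<in> B} = {\<omega> \<in> space N. ?v \<omega> \<in> B}"
      "{\<omega> \<in> space N. random_set U (n - 1) \<omega> \<in> space ?S} = space N"
      using measurable_space[OF g] measurable_space[OF X'] by blast+
    then show ?thesis
      using joint[OF sets.top that] N.emeasure_space_1 by simp
  qed
  have "distr N ?S ?g = distr N ?S (random_set U (n - 1))"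
  proof (rule measure_eqI)
    fix E assume "E \<in> sets (distr N ?S ?g)"
    then have E: "E \<in> sets ?S" by simp
    with g_eq[OF E] g X' show "emeasure (distr N ?S ?g) E = emeasure (distr N ?S (random_set U (n - 1))) E"
      by (simp add: emeasure_distr vimage_def Int_def conj_commute)
  qed simp
  moreover have "residue \<in> nsets_algebra {0..1} n \<rightarrow>\<^sub>M restrict_space borel {0..1}"
  proof (rule measurable_restrict_space2)
    show "residue \<in> space (nsets_algebra {0..1} n) \<rightarrow> {0..1}"
      by (auto simp: residue_def less_imp_le frac_lt_1)
  qed (rule measurable_residue, simp)
  moreover have "distr N borel ?v = ?u"
  proof (rule measure_eqI)
    fix B assume "B \<in> sets (distr N borel ?v)"
    then have B: "B \<in> sets borel" by simp
    with v_eq[OF B] v show "emeasure (distr N borel ?v) B = emeasure ?u B"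
      by (simp add: emeasure_distr vimage_def Int_def conj_commute del: emeasure_uniform_measure)
  qed simp
  moreover have "indep_rv N ?S ?g borel ?v"
    unfolding indep_rv_def
  proof (intro conjI g v N.indep_setI)
    fix a b
    assume "a \<in> {?g -` A \<inter> space N | A. A \<in> sets ?S}" "b \<in> {?v -` A \<inter> space N | A. A \<in> sets borel}"
    then obtain E B where E: "E \<in> sets ?S" and B: "B \<in> sets borel"
      and a: "a = {\<omega> \<in> space N. ?g \<omega> \<in> E}" and b: "b = {\<omega> \<in> space N. ?v \<omega> \<in> B}"
      by auto
    have "a \<inter> b = {\<omega> \<in> space N. ?g \<omega> \<in> E \<and> ?v \<omega> \<in> B}" by (auto simp: a b)
    then have "emeasure N (a \<inter> b) = emeasure N a * emeasure N b"
      unfolding a b g_eq[OF E] v_eq[OF B] using joint[OF E B] by (simp only: mult.commute)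
    then show "N.prob (a \<inter> b) = N.prob a * N.prob b"
      by (simp add: measure_def enn2real_mult)
  qed (use measurable_sets[OF g] measurable_sets[OF v] in auto)
  ultimately show ?thesis
    using thin by (intro exI[of _ thinning] exI[of _ residue] conjI) (auto simp: thinning_def)
qed

end
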